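(* (i) The class $\mathcal{MF}$ of MAT-free arrangements is not combinatorial. (ii) The subclass of $\mathcal{MF}$ consisting of the MAT-free arrangements defined over infinite fields is combinatorial.
   Context: Let $\mathbb{k}$ be a field and $V=\mathbb{k}^\ell$. A hyperplane arrangement $\mathcal{A}$ in $V$ is a finite set of (linear) hyperplanes in $V$. Its intersection lattice $L(\mathcal{A})$ is the set of all subspaces $H_1\cap\cdots\cap H_i$ for subsets $\{H_1,\dots,H_i\}\subseteq\mathcal{A}$ (the empty intersection being $V$), partially ordered by reverse inclusion. A class $\mathcal{C}$ of arrangements is called combinatorial if for every $\mathcal{A}\in\mathcal{C}$ and every arrangement $\mathcal{B}$ (possibly over a different field) with $L(\mathcal{B})\cong L(\mathcal{A})$ as lattices, we have $\mathcal{B}\in\mathcal{C}$. For a set $\pi$ of hyperplanes, $\operatorname{rk}(\pi)$ denotes the codimension of $\bigcap_{H\in\pi}H$. For an arrangement $\mathcal{A}'$ and a hyperplane $H\notin\mathcal{A}'$, write $(\mathcal{A}'\cup\{H\})^H=\{H'\cap H\mid H'\in\mathcal{A}'\}$, an arrangement in $H$ (a set, so coincidences are counted once). An arrangement $\mathcal{A}$ is MAT-free if there is an ordered partition $\pi=(\pi_1|\cdots|\pi_n)$ of $\mathcal{A}$ into nonempty blocks such that for every $0\le k\le n-1$, with $\mathcal{A}_k:=\bigcup_{i=1}^k\pi_i$ (so $\mathcal{A}_0=\emptyset$), the following hold: (a) $\operatorname{rk}(\pi_{k+1})=|\pi_{k+1}|$; (b) $\bigcap_{H\in\pi_{k+1}}H\not\subseteq\bigcup_{H'\in\mathcal{A}_k}H'$;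 (c) $|\mathcal{A}_k|-|(\mathcal{A}_k\cup\{H\})^H|=k$ for each $H\in\pi_{k+1}$. The class of MAT-free arrangements is denoted $\mathcal{MF}$.
   Formalization: In (ii), "combinatorial" is taken among arrangements over infinite fields: B is required to be over an infinite field. With B over any field the claim is false: the arrangement {x=0} over Q and over F_2 have isomorphic lattices, but the latter is not over an infinite field. *)

theory Defs
  imports "HOL-Algebra.Order" "Jordan_Normal_Form.Missing_VectorSpace"
begin

text \<open>
  The ground field varies, so fields are structures \<open>K :: 'u ring\<close> whose carrier is a subset of
  the type \<open>'u\<close>; a class of arrangements ranges over all fields carried by subsets of \<open>'u\<close>.
  Vectors of \<open>K\<^sup>l\<close> are the extensional functions from \<open>{..<l}\<close> to \<open>carrier K\<close>.
\<close>

abbreviation coord_space :: "'u ring \<Rightarrow> nat \<Rightarrow> ('u, nat \<Rightarrow> 'u) module" where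
  "coord_space K l \<equiv> ring.func_space K {..<l}"

definition codim :: "'u ring \<Rightarrow> nat \<Rightarrow> (nat \<Rightarrow> 'u) set \<Rightarrow> nat" where
  "codim K l W =
     vectorspace.dim K (coord_space K l) - vectorspace.dim K ((coord_space K l)\<lparr>carrier := W\<rparr>)"

definition hyperplane :: "'u ring \<Rightarrow> nat \<Rightarrow> (nat \<Rightarrow> 'u) set \<Rightarrow> bool" where
  "hyperplane K l H \<longleftrightarrow> subspace K H (coord_space K l) \<and> codim K l H = 1"

definition arrangement :: "'u ring \<Rightarrow> nat \<Rightarrow> (nat \<Rightarrow> 'u) set set \<Rightarrow> bool" where
  "arrangement K l A \<longleftrightarrow> field K \<and> finite A \<and> (\<forall>H\<in>A. hyperplane K l H)"

text \<open>Intersecting with the whole space makes the empty intersection equal to \<open>V\<close>.\<close>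

definition inter_space :: "'u ring \<Rightarrow> nat \<Rightarrow> (nat \<Rightarrow> 'u) set set \<Rightarrow> (nat \<Rightarrow> 'u) set" where
  "inter_space K l S = carrier (coord_space K l) \<inter> \<Inter>S"

definition rk :: "'u ring \<Rightarrow> nat \<Rightarrow> (nat \<Rightarrow> 'u) set set \<Rightarrow> nat" where
  "rk K l S = codim K l (inter_space K l S)"

definition intersection_lattice ::
    "'u ring \<Rightarrow> nat \<Rightarrow> (nat \<Rightarrow> 'u) set set \<Rightarrow> (nat \<Rightarrow> 'u) set gorder" where
  "intersection_lattice K l A =
     \<lparr>carrier = {inter_space K l S | S. S \<subseteq> A}, eq = (=), le = (\<supseteq>)\<rparr>"

text \<open>Isomorphisms of lattices are the bijections that preserve and reflect the order.\<close>

definition lattice_iso :: "'a gorder \<Rightarrow> 'b gorder \<Rightarrow> bool" where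
  "lattice_iso L M \<longleftrightarrow> (\<exists>\<phi>. bij_betw \<phi> (carrier L) (carrier M) \<and> order_emb L M \<phi>)"

text \<open>For \<open>H \<notin> A\<close>, this is the restriction of \<open>A \<union> {H}\<close> to \<open>H\<close>.\<close>

definition restriction :: "(nat \<Rightarrow> 'u) set set \<Rightarrow> (nat \<Rightarrow> 'u) set \<Rightarrow> (nat \<Rightarrow> 'u) set set" where
  "restriction A H = {H' \<inter> H | H'. H' \<in> A}"

definition ordered_partition :: "'a set list \<Rightarrow> 'a set \<Rightarrow> bool" where
  "ordered_partition \<pi> A \<longleftrightarrow>
     \<Union>(set \<pi>) = A \<and> {} \<notin> set \<pi> \<and>
     (\<forall>i<length \<pi>. \<forall>j<length \<pi>. i \<noteq> j \<longrightarrow> \<pi> ! i \<inter> \<pi> ! j = {})"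

text \<open>
  List indices start at 0: \<open>\<pi> ! k\<close> is the block $\pi_{k+1}$ and \<open>\<Union>(set (take k \<pi>))\<close> is the union
  $\mathcal{A}_k$ of the first \<open>k\<close> blocks. The empty list makes the empty arrangement MAT-free.
\<close>

definition MAT_partition ::
    "'u ring \<Rightarrow> nat \<Rightarrow> (nat \<Rightarrow> 'u) set set \<Rightarrow> (nat \<Rightarrow> 'u) set set list \<Rightarrow> bool" where
  "MAT_partition K l A \<pi> \<longleftrightarrow>
     ordered_partition \<pi> A \<and>
     (\<forall>k<length \<pi>. let A\<^sub>k = \<Union>(set (take k \<pi>)) in
        rk K l (\<pi> ! k) = card (\<pi> ! k) \<and>
        \<not> inter_space K l (\<pi> ! k) \<subseteq> \<Union>A\<^sub>k \<and>
        (\<forall>H\<in>\<pi> ! k. int (card A\<^sub>k) - int (card (restriction A\<^sub>k H)) = int k))"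

definition MAT_free :: "'u ring \<Rightarrow> nat \<Rightarrow> (nat \<Rightarrow> 'u) set set \<Rightarrow> bool" where
  "MAT_free K l A \<longleftrightarrow> (\<exists>\<pi>. MAT_partition K l A \<pi>)"

type_synonym 'u arr = "'u ring \<times> nat \<times> (nat \<Rightarrow> 'u) set set"

definition all_arrangements :: "'u arr set" where
  "all_arrangements = {(K, l, A). arrangement K l A}"

definition infinite_field_arrangements :: "'u arr set" where
  "infinite_field_arrangements = {(K, l, A). arrangement K l A \<and> infinite (carrier K)}"

definition MF :: "'u arr set" where
  "MF = {(K, l, A). arrangement K l A \<and> MAT_free K l A}"

text \<open>
  A class \<open>C\<close> is combinatorial within an ambient class \<open>D\<close> of arrangements if it is closed under
  lattice isomorphism among the members of \<open>D\<close>; both the field and the dimension may change.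
  With \<open>D = all_arrangements\<close> this is the absolute notion. For the arrangements over infinite
  fields the absolute notion is too strict: a Boolean arrangement has the same lattice over
  every field, so no class of arrangements over infinite fields containing it is combinatorial
  among all arrangements.
\<close>

definition combinatorial_within :: "'u arr set \<Rightarrow> 'u arr set \<Rightarrow> bool" where
  "combinatorial_within D C \<longleftrightarrow>
     (\<forall>K l A K' l' B. (K, l, A) \<in> C \<and> (K', l', B) \<in> D \<and>
        lattice_iso (intersection_lattice K' l' B) (intersection_lattice K l A) \<longrightarrow>
        (K', l', B) \<in> C)"

abbreviation combinatorial :: "'u arr set \<Rightarrow> bool" where
  "combinatorial \<equiv> combinatorial_within all_arrangements"

end

theory Submission
  imports Defs
begin

text \<open>
  All conditions on a MAT-partition except (b) depend only on which intersections
  $\bigcap_{H \in T} H$ lie in which hyperplanes: the rank of $\pi_k$ is $|\pi_k|$ iff no $H \in \pi_k$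
  contains the intersection of the others, and $H_1 \cap H = H_2 \cap H$ iff each of $H_1$, $H_2$ contains the
  intersection of the other with $H$. A lattice isomorphism maps hyperplanes, the coatoms for
  inclusion, to hyperplanes and preserves these inclusions. Over an infinite field a subspace covered
  by finitely many hyperplanes lies in one of them, so (b) is of this kind as well.

  Over a finite field (b) is more restrictive. The seven linear forms over $\mathbb{F}_2$ in three
  variables define the Fano arrangement over $\mathbb{F}_2$ and over $\mathbb{F}_4$, with isomorphic
  lattices. Over $\mathbb{F}_4$ it is MAT-free, by the blocks
  $x, y, z \mid x+y, y+z \mid x+y+z \mid x+z$; over $\mathbb{F}_2$ it is not.
\<close>

section \<open>Hyperplanes in coordinate spaces\<close>

context vectorspace
begin

text \<open>Independence in \<open>W\<close> is the same as independence in \<open>V\<close>, so dim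
  V bounds the size of independent subsets of \<open>W\<close>; a maximal one is a finite
  basis.\<close>

lemma subspace_fin_dim:
  assumes fd: fin_dim and W: "subspace K W V"
  shows "vectorspace.fin_dim K (vs W)"
proof -
  interpret W: vectorspace K "vs W"
    by (rule subspace_is_vs[OF W])
  have sub: "submodule K W V" using W by simp
  have WV: "W \<subseteq> carrier V" by (rule submodule.subset[OF sub])
  have "finite A \<and> card A \<le> dim" if "A \<subseteq> carrier (vs W) \<and> W.lin_indpt A" for A
    using that li_le_dim[OF fd, of A] WV span_li_not_depend(2)[OF _ sub, of A] by auto
  moreover have "W.lin_indpt {}" unfolding W.lin_dep_def by auto
  ultimately obtain A where "finite A" and A: "maximal A (\<lambda>S. S \<subseteq> carrier (vs W) \<and> W.lin_indpt S)"
    using maximal_exists[of "\<lambda>S. S \<subseteq> carrier (vs W) \<and> W.lin_indpt S" dim "{}"] by auto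
  then show ?thesis
    using W.max_li_is_basis[OF A] unfolding W.basis_def W.fin_dim_def by blast
qed

text \<open>As \<open>u\<close> lies outside span A = W, it can be adjoined to a basis of
  \<open>W\<close>. Both the dimension count and the decomposition along \<open>u\<close> below
  start from this independent set.\<close>

lemma basis_insert_lin_indpt:
  assumes W: "subspace K W V" and fd: "vectorspace.fin_dim K (vs W)"
    and u: "u \<in> carrier V" "u \<notin> W"
  obtains A where "finite A" "A \<subseteq> W" "span A = W" "u \<notin> A" "lin_indpt (insert u A)"
    "card A = vectorspace.dim K (vs W)"
proof -
  interpret W: vectorspace K "vs W"
    by (rule subspace_is_vs[OF W])
  have sub: "submodule K W V" using W by simp
  have WV: "W \<subseteq> carrier V" by (rule submodule.subset[OF sub])
  obtain A where A: "finite A" "W.basis A" using W.finite_basis_exists[OF fd] by blast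
  have AW: "A \<subseteq> W" and gen: "W.span A = W" and li: "W.lin_indpt A"
    using A(2) unfolding W.basis_def by auto
  have span: "span A = W" using span_li_not_depend(1)[OF AW sub] gen by simp
  have liA: "lin_indpt A" using span_li_not_depend(2)[OF AW sub] li by simp
  have uA: "u \<notin> A" using u AW by auto
  have "lin_indpt (insert u A)"
    using lin_dep_iff_in_span[OF _ liA u(1) uA] AW WV span u(2) by auto
  then show ?thesis using that A(1) AW span uA W.dim_basis[OF A] by simp
qed

text \<open>The assumption \<open>decomp\<close> expresses U = W + K u, so adjoining
  \<open>u\<close> to a basis of \<open>W\<close> gives a basis of \<open>U\<close>.\<close>

lemma dim_add_vector:
  assumes W: "subspace K W V" and fd: "vectorspace.fin_dim K (vs W)"
    and U: "subspace K U V" and WU: "W \<subseteq> U" and u: "u \<in> U" "u \<notin> W"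
    and decomp: "\<And>x. x \<in> U \<Longrightarrow> \<exists>w\<in>W. \<exists>c\<in>carrier K. x = w \<oplus>\<^bsub>V\<^esub> c \<odot>\<^bsub>V\<^esub> u"
  shows "vectorspace.fin_dim K (vs U)"
    and "vectorspace.dim K (vs U) = Suc (vectorspace.dim K (vs W))"
proof -
  interpret U: vectorspace K "vs U"
    by (rule subspace_is_vs[OF U])
  have subU: "submodule K U V" using U by simp
  have UV: "U \<subseteq> carrier V" by (rule submodule.subset[OF subU])
  obtain A where A: "finite A" "A \<subseteq> W" "span A = W" "u \<notin> A" "lin_indpt (insert u A)"
    "card A = vectorspace.dim K (vs W)"
    using basis_insert_lin_indpt[OF W fd] u UV by blast
  have uAU: "insert u A \<subseteq> U" using u A WU by auto
  then have uAV: "insert u A \<subseteq> carrier V" using UV by auto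
  have subs: "submodule K (span (insert u A)) V" by (rule span_is_submodule[OF uAV])
  have Wspan: "W \<subseteq> span (insert u A)" using span_is_monotone[of A "insert u A"] A(3) by auto
  have uspan: "u \<in> span (insert u A)" using in_own_span[OF uAV] by auto
  have "U \<subseteq> span (insert u A)"
    using decomp Wspan submodule.m_closed[OF subs] submodule.smult_closed[OF subs _ uspan] by blast
  moreover have "span (insert u A) \<subseteq> U" by (rule span_is_subset[OF uAU subU])
  ultimately have "U.basis (insert u A)"
    unfolding U.basis_def using span_li_not_depend[OF uAU subU] A(5) uAU by auto
  then show "U.fin_dim" "U.dim = Suc (vectorspace.dim K (vs W))"
    using U.dim_basis[of "insert u A"] A unfolding U.basis_def U.fin_dim_def by auto
qed

text \<open>A basis of \<open>W\<close> with \<open>u\<close> adjoined is independent of size dim V,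
  hence a basis of \<open>V\<close>; \<open>c\<close> is the coefficient of \<open>u\<close> in the
  expansion of \<open>x\<close>.\<close>

lemma codim_one_decomposition:
  assumes fd: fin_dim and W: "subspace K W V" and dim: "dim = Suc (vectorspace.dim K (vs W))"
    and u: "u \<in> carrier V" "u \<notin> W" and x: "x \<in> carrier V"
  shows "\<exists>w\<in>W. \<exists>c\<in>carrier K. x = w \<oplus>\<^bsub>V\<^esub> c \<odot>\<^bsub>V\<^esub> u"
proof -
  have sub: "submodule K W V" using W by simp
  have WV: "W \<subseteq> carrier V" by (rule submodule.subset[OF sub])
  obtain A where A: "finite A" "A \<subseteq> W" "span A = W" "u \<notin> A" "lin_indpt (insert u A)"
    "card A = vectorspace.dim K (vs W)"
    using basis_insert_lin_indpt[OF W subspace_fin_dim[OF fd W] u] by blast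
  have uAV: "insert u A \<subseteq> carrier V" "A \<subseteq> carrier V" using u(1) A(2) WV by auto
  have "basis (insert u A)"
    by (rule dim_li_is_basis[OF fd]) (use A dim uAV in auto)
  then have "x \<in> span (insert u A)" using x unfolding basis_def by auto
  then obtain a where a: "a \<in> insert u A \<rightarrow> carrier K" "lincomb a (insert u A) = x"
    using finite_in_span[OF _ uAV(1), of x] A(1) by auto
  have "x = a u \<odot>\<^bsub>V\<^esub> u \<oplus>\<^bsub>V\<^esub> lincomb a A"
    using lincomb_insert2[OF A(1) uAV(2) _ A(4) u(1), of a] a by simp
  moreover have "lincomb a A \<in> W" using A(1,3) a(1) unfolding span_def by blast
  ultimately show ?thesis
    using a(1) u(1) WV by (metis M.a_comm PiE insertI1 smult_closed subsetD)
qed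

end

section \<open>Hyperplanes of the coordinate space\<close>

locale coordinate_space = field K for K :: "'u ring" (structure) + fixes l :: nat
begin

abbreviation V :: "('u, nat \<Rightarrow> 'u) module" where "V \<equiv> coord_space K l"

lemma carrier_V: "carrier V = {..<l} \<rightarrow>\<^sub>E carrier K"
  and zero_V: "\<zero>\<^bsub>V\<^esub> = (\<lambda>i\<in>{..<l}. \<zero>)"
  and add_V: "f \<oplus>\<^bsub>V\<^esub> g = (\<lambda>i\<in>{..<l}. f i \<oplus> g i)"
  and smult_V: "c \<odot>\<^bsub>V\<^esub> f = (\<lambda>i\<in>{..<l}. c \<otimes> f i)"
  unfolding func_space_def by simp_all

sublocale VS: vectorspace K V
  by (intro vectorspace.intro func_space_is_module field_axioms)

lemma subspaceI:
  assumes "W \<subseteq> carrier V" "\<zero>\<^bsub>V\<^esub> \<in> W" "\<And>v w. v \<in> W \<Longrightarrow> w \<in> W \<Longrightarrow> v \<oplus>\<^bsub>V\<^esub> w \<in> W"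
    "\<And>c v. c \<in> carrier K \<Longrightarrow> v \<in> W \<Longrightarrow> c \<odot>\<^bsub>V\<^esub> v \<in> W"
  shows "subspace K W V"
  using assms VS.vectorspace_axioms VS.module_axioms
  unfolding subspace_def LinearCombinations.submodule_def by blast

lemma subspaceD:
  assumes "subspace K W V"
  shows "W \<subseteq> carrier V" "\<zero>\<^bsub>V\<^esub> \<in> W" "\<And>v w. v \<in> W \<Longrightarrow> w \<in> W \<Longrightarrow> v \<oplus>\<^bsub>V\<^esub> w \<in> W"
    "\<And>c v. c \<in> carrier K \<Longrightarrow> v \<in> W \<Longrightarrow> c \<odot>\<^bsub>V\<^esub> v \<in> W"
  using assms unfolding subspace_def LinearCombinations.submodule_def by blast+

lemma subspace_carrier: "subspace K (carrier V) V"
  by (rule subspaceI)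
    (simp_all add: VS.M.a_closed VS.smult_closed VS.M.zero_closed)

lemma subspace_Int:
  assumes W: "subspace K W V" and U: "subspace K U V"
  shows "subspace K (W \<inter> U) V"
proof (rule subspaceI)
  show "W \<inter> U \<subseteq> carrier V" using subspaceD(1)[OF W] by blast
  show "\<zero>\<^bsub>V\<^esub> \<in> W \<inter> U" using subspaceD(2)[OF W] subspaceD(2)[OF U] by blast
qed (use subspaceD(3,4)[OF W] subspaceD(3,4)[OF U] in \<open>auto\<close>)

lemma subspace_diff:
  assumes W: "subspace K W V" and x: "x \<in> carrier V" and w: "w \<in> W" "x \<oplus>\<^bsub>V\<^esub> w \<in> W"
  shows "x \<in> W"
proof -
  have "\<ominus>\<^bsub>V\<^esub> w \<in> W"
    using subspaceD(4)[OF W _ w(1), of "\<ominus> \<one>"] VS.smult_minus_1[of w] subspaceD(1)[OF W] w(1) by auto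
  then have "(x \<oplus>\<^bsub>V\<^esub> w) \<oplus>\<^bsub>V\<^esub> \<ominus>\<^bsub>V\<^esub> w \<in> W" using subspaceD(3)[OF W] w by blast
  moreover have "w \<in> carrier V" using subspaceD(1)[OF W] w by blast
  ultimately show ?thesis using x by (simp add: VS.M.a_assoc VS.M.r_neg)
qed

text \<open>There is a flag from 0 to V: \<open>W j\<close> consists of the vectors that vanish from
  coordinate \<open>j\<close> on, and \<open>W (Suc j)\<close> arises from it by adding one unit
  vector.\<close>

lemma fin_dim_V: "VS.fin_dim"
proof -
  define W where "W j = {v \<in> carrier V. \<forall>i<l. j \<le> i \<longrightarrow> v i = \<zero>}" for j
  have sub: "subspace K (W j) V" for j
    by (rule subspaceI) (auto simp: W_def carrier_V zero_V add_V smult_V)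
  have "vectorspace.fin_dim K (VS.vs (W j))" if "j \<le> l" for j
    using that
  proof (induction j)
    case 0
    interpret W0: vectorspace K "VS.vs (W 0)" by (rule VS.subspace_is_vs[OF sub])
    have "W 0 = {\<zero>\<^bsub>V\<^esub>}"
      by (auto simp: W_def carrier_V zero_V PiE_def extensional_def)
    then have "W0.gen_set {}" using W0.span_empty by simp
    then show ?case unfolding W0.fin_dim_def by (intro exI[of _ "{}"]) auto
  next
    case (Suc j)
    let ?u = "\<lambda>i\<in>{..<l}. if i = j then \<one> else \<zero>"
    show ?case
    proof (rule VS.dim_add_vector(1)[OF sub _ sub, of j "Suc j" ?u])
      fix x assume x: "x \<in> W (Suc j)"
      have "x i \<in> carrier K" if "i < l" for i
        using x that by (auto simp: W_def carrier_V)
      then have "x = x(j := \<zero>) \<oplus>\<^bsub>V\<^esub> x j \<odot>\<^bsub>V\<^esub> ?u"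
        using x Suc.prems by (auto simp: W_def carrier_V add_V smult_V PiE_def extensional_def fun_eq_iff)
      moreover have "x(j := \<zero>) \<in> W j" "x j \<in> carrier K"
        using x Suc.prems by (auto simp: W_def carrier_V PiE_def extensional_def)
      ultimately show "\<exists>w\<in>W j. \<exists>c\<in>carrier K. x = w \<oplus>\<^bsub>V\<^esub> c \<odot>\<^bsub>V\<^esub> ?u" by blast
    qed (use Suc in \<open>auto simp: W_def carrier_V\<close>)
  qed
  moreover have "W l = carrier V" by (auto simp: W_def)
  ultimately show ?thesis by fastforce
qed

abbreviation dim :: "(nat \<Rightarrow> 'u) set \<Rightarrow> nat" where
  "dim W \<equiv> vectorspace.dim K (VS.vs W)"

lemma dim_carrier: "dim (carrier V) = VS.dim"
  by simp

lemma hyperplaneD: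
  assumes "hyperplane K l H"
  shows "subspace K H V" "VS.dim = Suc (dim H)"
  using assms unfolding hyperplane_def codim_def by auto

lemma hyperplane_decomposition:
  assumes H: "hyperplane K l H" and u: "u \<in> carrier V" "u \<notin> H" and x: "x \<in> carrier V"
  obtains h c where "h \<in> H" "c \<in> carrier K" "x = h \<oplus>\<^bsub>V\<^esub> c \<odot>\<^bsub>V\<^esub> u"
  using VS.codim_one_decomposition[OF fin_dim_V hyperplaneD[OF H] u x] by blast

text \<open>A vector \<open>u\<close> of \<open>W\<close> outside \<open>H\<close> splits every
  \<open>x\<close> in \<open>W\<close> as h + c u with h in \<open>H\<close>. Then h = x - c u is
  again in \<open>W\<close>, so W = (W \<inter> H) + K u.\<close>

lemma dim_Int_hyperplane:
  assumes H: "hyperplane K l H" and W: "subspace K W V" and WH: "\<not> W \<subseteq> H"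
  shows "dim W = Suc (dim (W \<inter> H))"
proof -
  obtain u where u: "u \<in> W" "u \<notin> H" using WH by blast
  have uV: "u \<in> carrier V" using u subspaceD(1)[OF W] by blast
  have WHs: "subspace K (W \<inter> H) V" by (rule subspace_Int[OF W hyperplaneD(1)[OF H]])
  show ?thesis
  proof (rule VS.dim_add_vector(2)[OF WHs _ W _ u(1)])
    show "vectorspace.fin_dim K (VS.vs (W \<inter> H))"
      by (rule VS.subspace_fin_dim[OF fin_dim_V WHs])
    fix x assume x: "x \<in> W"
    obtain h c where hc: "h \<in> H" "c \<in> carrier K" "x = h \<oplus>\<^bsub>V\<^esub> c \<odot>\<^bsub>V\<^esub> u"
      using hyperplane_decomposition[OF H uV u(2)] x subspaceD(1)[OF W] by blast
    have "h \<in> W"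
      using subspace_diff[OF W, of h "c \<odot>\<^bsub>V\<^esub> u"] hc x u subspaceD(4)[OF W]
        subspaceD(1)[OF hyperplaneD(1)[OF H]] by blast
    then show "\<exists>w\<in>W \<inter> H. \<exists>c\<in>carrier K. x = w \<oplus>\<^bsub>V\<^esub> c \<odot>\<^bsub>V\<^esub> u" using hc by blast
  qed (use u in auto)
qed

text \<open>A basis of \<open>W\<close> is independent in \<open>V\<close>. The bound makes the
  truncated subtraction in \<open>codim\<close> a true one.\<close>

lemma dim_le:
  assumes W: "subspace K W V"
  shows "dim W \<le> VS.dim"
proof -
  interpret W: vectorspace K "VS.vs W" by (rule VS.subspace_is_vs[OF W])
  obtain B where B: "finite B" "W.basis B"
    using W.finite_basis_exists[OF VS.subspace_fin_dim[OF fin_dim_V W]] by blast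
  then have "B \<subseteq> W" "VS.lin_indpt B"
    using VS.span_li_not_depend(2)[of B W] W unfolding W.basis_def by auto
  then show ?thesis
    using VS.li_le_dim(2)[OF fin_dim_V, of B] subspaceD(1)[OF W] W.dim_basis[OF B] by auto
qed

lemma hyperplaneI:
  assumes H: "subspace K H V" and u: "u \<in> carrier V" "u \<notin> H"
    and decomp: "\<And>x. x \<in> carrier V \<Longrightarrow> \<exists>w\<in>H. \<exists>c\<in>carrier K. x = w \<oplus>\<^bsub>V\<^esub> c \<odot>\<^bsub>V\<^esub> u"
  shows "hyperplane K l H"
  using VS.dim_add_vector(2)[OF H VS.subspace_fin_dim[OF fin_dim_V H] subspace_carrier
      subspaceD(1)[OF H] u decomp] H
  unfolding hyperplane_def codim_def by simp

lemma hyperplane_proper: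
  assumes "hyperplane K l H"
  shows "H \<subset> carrier V"
  using subspaceD(1)[OF hyperplaneD(1)[OF assms]] hyperplaneD(2)[OF assms] dim_carrier
  by (metis n_not_Suc_n psubsetI)

text \<open>Otherwise H = H' \<inter> H would have dimension one less than \<open>H'\<close>,
  although all hyperplanes have the same dimension.\<close>

lemma hyperplane_subset_imp_eq:
  assumes H: "hyperplane K l H" and H': "hyperplane K l H'" and sub: "H \<subseteq> H'"
  shows "H = H'"
proof (rule ccontr)
  assume "H \<noteq> H'"
  then have "dim H' = Suc (dim (H' \<inter> H))"
    using sub by (intro dim_Int_hyperplane[OF H hyperplaneD(1)[OF H']]) auto
  moreover have "H' \<inter> H = H" using sub by blast
  ultimately show False using hyperplaneD(2)[OF H] hyperplaneD(2)[OF H'] by simp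
qed

section \<open>Intersections of hyperplanes and their rank\<close>

lemma inter_space_insert: "inter_space K l (insert H S) = inter_space K l S \<inter> H"
  unfolding inter_space_def by auto

lemma inter_space_empty: "inter_space K l {} = carrier V"
  unfolding inter_space_def by simp

lemma inter_space_antimono: "S \<subseteq> T \<Longrightarrow> inter_space K l T \<subseteq> inter_space K l S"
  unfolding inter_space_def by auto

lemma subspace_inter_space:
  assumes "\<And>H. H \<in> S \<Longrightarrow> hyperplane K l H"
  shows "subspace K (inter_space K l S) V"
  by (rule subspaceI)
    (use subspaceD[OF hyperplaneD(1)[OF assms]] subspaceD[OF subspace_carrier]
      in \<open>auto simp: inter_space_def\<close>)

lemma rk_empty: "rk K l {} = 0"
  unfolding rk_def codim_def inter_space_empty by simp

lemma rk_insert: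
  assumes "\<And>H'. H' \<in> insert H S \<Longrightarrow> hyperplane K l H'"
  shows "rk K l (insert H S) = (if inter_space K l S \<subseteq> H then rk K l S else Suc (rk K l S))"
proof (cases "inter_space K l S \<subseteq> H")
  case True
  then show ?thesis unfolding rk_def inter_space_insert by (simp add: Int_absorb2)
next
  case False
  have sub: "subspace K (inter_space K l S) V" using assms by (intro subspace_inter_space) auto
  have "dim (inter_space K l S) = Suc (dim (inter_space K l S \<inter> H))"
    using assms False by (intro dim_Int_hyperplane[OF _ sub]) auto
  then show ?thesis
    using False dim_le[OF sub] unfolding rk_def codim_def inter_space_insert by simp
qed

lemma rk_le_card:
  assumes "finite S" "\<And>H. H \<in> S \<Longrightarrow> hyperplane K l H"
  shows "rk K l S \<le> card S"
  using assms
proof (induction S)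
  case empty
  then show ?case by (simp add: rk_empty)
next
  case (insert H S)
  then show ?case using rk_insert[of H S] by (auto split: if_splits)
qed

text \<open>If \<open>H\<close> contains the intersection of the others, dropping it keeps the rank,
  which is then at most |S| - 1. If this never happens, every insertion raises the rank by one.
  Condition (a) thus becomes a statement about containments in hyperplanes.\<close>

lemma rk_eq_card_iff:
  assumes fin: "finite S" and hyp: "\<And>H. H \<in> S \<Longrightarrow> hyperplane K l H"
  shows "rk K l S = card S \<longleftrightarrow> (\<forall>H\<in>S. \<not> inter_space K l (S - {H}) \<subseteq> H)"
proof
  assume eq: "rk K l S = card S"
  show "\<forall>H\<in>S. \<not> inter_space K l (S - {H}) \<subseteq> H"
  proof (intro ballI notI)
    fix H assume H: "H \<in> S" "inter_space K l (S - {H}) \<subseteq> H"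
    have "rk K l S = rk K l (S - {H})"
      using rk_insert[of H "S - {H}"] H hyp by (auto simp: insert_absorb)
    also have "\<dots> \<le> card (S - {H})" using fin hyp by (intro rk_le_card) auto
    also have "\<dots> < card S" using fin H by (meson card_Diff1_less)
    finally show False using eq by simp
  qed
next
  assume "\<forall>H\<in>S. \<not> inter_space K l (S - {H}) \<subseteq> H"
  with assms show "rk K l S = card S"
  proof (induction S)
    case empty
    then show ?case by (simp add: rk_empty)
  next
    case (insert H S)
    have "\<not> inter_space K l (S - {H'}) \<subseteq> H'" if "H' \<in> S" for H'
      using insert.prems(2) that inter_space_antimono[of "S - {H'}" "insert H S - {H'}"] by blast
    then have "rk K l S = card S" using insert.IH insert.prems(1) by blast
    moreover have "\<not> inter_space K l S \<subseteq> H" using insert.prems(2) insert.hyps by auto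
    ultimately show ?case using insert rk_insert[of H S] by auto
  qed
qed

text \<open>By induction on \<open>S\<close>, a vector of \<open>W\<close> outside all members is
  found. If \<open>w\<close> avoids \<open>S\<close> but lies in the new \<open>H\<close>, choose
  \<open>u\<close> in \<open>W\<close> outside \<open>H\<close>. No vector u + c w lies in
  \<open>H\<close>, and each member of \<open>S\<close> contains at most one of them, so an infinite
  field leaves a suitable \<open>c\<close>.\<close>

lemma subspace_subset_Union_hyperplanes:
  assumes inf: "infinite (carrier K)" and W: "subspace K W V"
    and fin: "finite S" and hyp: "\<And>H. H \<in> S \<Longrightarrow> hyperplane K l H"
    and WS: "W \<subseteq> \<Union>S"
  shows "\<exists>H\<in>S. W \<subseteq> H"
proof (rule ccontr)
  assume "\<not> (\<exists>H\<in>S. W \<subseteq> H)"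
  then have nsub: "\<forall>H\<in>S. \<not> W \<subseteq> H" by blast
  have "\<exists>w\<in>W. w \<notin> \<Union>S" using fin hyp nsub
  proof (induction S)
    case empty
    then show ?case using subspaceD(2)[OF W] by blast
  next
    case (insert H S)
    then obtain w where w: "w \<in> W" "w \<notin> \<Union>S" by auto
    obtain u where u: "u \<in> W" "u \<notin> H" using insert.prems by blast
    show ?case
    proof (cases "w \<in> H")
      case False
      then show ?thesis using w by blast
    next
      case True
      have wuV: "w \<in> carrier V" "u \<in> carrier V" using w u subspaceD(1)[OF W] by auto
      \<comment> \<open>These are the scalars excluded by \<open>H'\<close>. Two distinct ones c, d
        would put (c - d) w, and hence \<open>w\<close>, into \<open>H'\<close>.\<close>
      define bad where "bad H' = {c \<in> carrier K. u \<oplus>\<^bsub>V\<^esub> c \<odot>\<^bsub>V\<^esub> w \<in> H'}" for H'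
      have "finite (bad H')" if H': "H' \<in> S" for H'
      proof -
        have H's: "subspace K H' V" using insert.prems H' hyperplaneD(1) by blast
        have wH': "w \<notin> H'" using w H' by blast
        have "c = d" if "c \<in> bad H'" "d \<in> bad H'" for c d
        proof (rule ccontr)
          assume "c \<noteq> d"
          have cd: "c \<in> carrier K" "d \<in> carrier K" using that unfolding bad_def by auto
          then have unit: "c \<ominus> d \<in> Units K" using \<open>c \<noteq> d\<close> field_Units by auto
          have "(c \<ominus> d) \<odot>\<^bsub>V\<^esub> w \<oplus>\<^bsub>V\<^esub> (u \<oplus>\<^bsub>V\<^esub> d \<odot>\<^bsub>V\<^esub> w) = u \<oplus>\<^bsub>V\<^esub> c \<odot>\<^bsub>V\<^esub> w"
          proof -
            have "(c \<ominus> d) \<odot>\<^bsub>V\<^esub> w \<oplus>\<^bsub>V\<^esub> d \<odot>\<^bsub>V\<^esub> w = c \<odot>\<^bsub>V\<^esub> w"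
              using cd wuV by (simp add: VS.smult_l_distr[symmetric] a_minus_def a_assoc l_neg)
            then show ?thesis using cd wuV
              by (metis VS.M.a_lcomm VS.smult_closed minus_closed)
          qed
          then have "(c \<ominus> d) \<odot>\<^bsub>V\<^esub> w \<in> H'"
            using subspace_diff[OF H's, of "(c \<ominus> d) \<odot>\<^bsub>V\<^esub> w" "u \<oplus>\<^bsub>V\<^esub> d \<odot>\<^bsub>V\<^esub> w"] that cd wuV
            unfolding bad_def by simp
          then have "inv (c \<ominus> d) \<odot>\<^bsub>V\<^esub> ((c \<ominus> d) \<odot>\<^bsub>V\<^esub> w) \<in> H'"
            using subspaceD(4)[OF H's] unit by blast
          then have "w \<in> H'"
            using unit wuV cd by (simp add: VS.smult_assoc1[symmetric] Units_l_inv)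
          then show False using wH' by blast
        qed
        then have "is_singleton (bad H') \<or> bad H' = {}" by (meson is_singletonI' )
        then show ?thesis by (auto elim: is_singletonE)
      qed
      then have "finite (\<Union>H'\<in>S. bad H')" using insert.hyps by blast
      then obtain c where c: "c \<in> carrier K" "c \<notin> (\<Union>H'\<in>S. bad H')"
        using inf by (meson ex_new_if_finite finite_subset subsetI)
      have "u \<oplus>\<^bsub>V\<^esub> c \<odot>\<^bsub>V\<^esub> w \<notin> \<Union>S" using c unfolding bad_def by blast
      moreover have "u \<oplus>\<^bsub>V\<^esub> c \<odot>\<^bsub>V\<^esub> w \<notin> H"
      proof -
        have Hs: "subspace K H V" using insert.prems hyperplaneD(1) by blast
        show ?thesis
          using subspace_diff[OF Hs wuV(2), of "c \<odot>\<^bsub>V\<^esub> w"] subspaceD(4)[OF Hs c(1) True] u(2) by blast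
      qed
      moreover have "u \<oplus>\<^bsub>V\<^esub> c \<odot>\<^bsub>V\<^esub> w \<in> W"
        using subspaceD(3,4)[OF W] c(1) u(1) w(1) by blast
      ultimately show ?thesis by blast
    qed
  qed
  then show False using WS by blast
qed

end

section \<open>Transfer along lattice isomorphisms\<close>

context coordinate_space
begin

text \<open>These consequences of (a) and (b) speak only of an intersection lying in a single
  hyperplane, a relation that lattice isomorphisms preserve. Over a finite field the second can be
  weaker than (b).\<close>

lemma MAT_partition_imp_closure_conditions:
  assumes A: "arrangement K l A" and \<pi>: "MAT_partition K l A \<pi>" and k: "k < length \<pi>"
  shows "\<And>H. H \<in> \<pi> ! k \<Longrightarrow> \<not> inter_space K l (\<pi> ! k - {H}) \<subseteq> H"
    and "\<And>H. H \<in> \<Union>(set (take k \<pi>)) \<Longrightarrow> \<not> inter_space K l (\<pi> ! k) \<subseteq> H"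
proof -
  have "\<pi> ! k \<subseteq> A" using \<pi> k unfolding MAT_partition_def ordered_partition_def by auto
  then have "finite (\<pi> ! k)" "\<And>H. H \<in> \<pi> ! k \<Longrightarrow> hyperplane K l H"
    using A unfolding arrangement_def by (auto intro: finite_subset)
  then show "\<And>H. H \<in> \<pi> ! k \<Longrightarrow> \<not> inter_space K l (\<pi> ! k - {H}) \<subseteq> H"
    using rk_eq_card_iff \<pi> k unfolding MAT_partition_def Let_def by metis
  show "\<And>H. H \<in> \<Union>(set (take k \<pi>)) \<Longrightarrow> \<not> inter_space K l (\<pi> ! k) \<subseteq> H"
    using \<pi> k unfolding MAT_partition_def Let_def by blast
qed

text \<open>Condition (a) is replaced by its containment form, while (b) keeps the union: over a
  finite field a subspace may be covered by hyperplanes without lying in any of them.\<close>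

lemma MAT_partitionI:
  assumes A: "arrangement K l A" and part: "ordered_partition \<pi> A"
    and indep: "\<And>k H. k < length \<pi> \<Longrightarrow> H \<in> \<pi> ! k \<Longrightarrow> \<not> inter_space K l (\<pi> ! k - {H}) \<subseteq> H"
    and avoid: "\<And>k. k < length \<pi> \<Longrightarrow> \<not> inter_space K l (\<pi> ! k) \<subseteq> \<Union>(\<Union>(set (take k \<pi>)))"
    and card: "\<And>k H. k < length \<pi> \<Longrightarrow> H \<in> \<pi> ! k \<Longrightarrow>
      int (card (\<Union>(set (take k \<pi>)))) - int (card (restriction (\<Union>(set (take k \<pi>))) H)) = int k"
  shows "MAT_partition K l A \<pi>"
proof -
  have "rk K l (\<pi> ! k) = card (\<pi> ! k)" if k: "k < length \<pi>" for k
  proof -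
    have "\<pi> ! k \<subseteq> A" using part k unfolding ordered_partition_def by auto
    then have "finite (\<pi> ! k)" "\<And>H. H \<in> \<pi> ! k \<Longrightarrow> hyperplane K l H"
      using A unfolding arrangement_def by (auto intro: finite_subset)
    then show ?thesis using rk_eq_card_iff indep[OF k] by blast
  qed
  then show ?thesis using part avoid card unfolding MAT_partition_def Let_def by blast
qed

text \<open>Every lattice element other than V lies in some member of \<open>A\<close>, and members
  of \<open>A\<close> are not properly nested. So exactly one element, V, lies strictly above a
  hyperplane, and this property singles the hyperplanes out.\<close>

lemma hyperplane_iff_coatom:
  assumes A: "arrangement K l A"
  defines "L \<equiv> carrier (intersection_lattice K l A)"
  shows "H \<in> A \<longleftrightarrow> H \<in> L \<and> (\<exists>X\<in>L. H \<subset> X \<and> (\<forall>Y\<in>L. H \<subset> Y \<longrightarrow> Y = X))"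
proof -
  have L: "L = {inter_space K l S |S. S \<subseteq> A}"
    unfolding L_def intersection_lattice_def by simp
  have hyp: "\<And>H. H \<in> A \<Longrightarrow> hyperplane K l H" using A unfolding arrangement_def by auto
  have V_L: "carrier V \<in> L" unfolding L using inter_space_empty by force
  have L_V: "X \<subseteq> carrier V" if "X \<in> L" for X using that unfolding L inter_space_def by auto
  have A_L: "H \<in> L" if H: "H \<in> A" for H
  proof -
    have "inter_space K l {H} = H"
      using hyperplane_proper[OF hyp[OF H]] unfolding inter_space_def by auto
    then show ?thesis using H unfolding L by blast
  qed
  have below: "\<exists>H\<in>A. X \<subseteq> H" if "X \<in> L" "X \<noteq> carrier V" for X
    using that unfolding L inter_space_def by auto
  have unique: "X = carrier V" if H: "H \<in> A" and X: "X \<in> L" "H \<subset> X" for H X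
  proof (rule ccontr)
    assume "X \<noteq> carrier V"
    then obtain H' where H': "H' \<in> A" "X \<subseteq> H'" using below X by blast
    then have "H = H'" using hyperplane_subset_imp_eq[OF hyp[OF H] hyp] X by blast
    then show False using H' X by blast
  qed
  show ?thesis
  proof
    assume H: "H \<in> A"
    have "\<forall>X\<in>L. H \<subset> X \<longrightarrow> X = carrier V" using unique[OF H] by blast
    then have "\<exists>X\<in>L. H \<subset> X \<and> (\<forall>Y\<in>L. H \<subset> Y \<longrightarrow> Y = X)"
      using V_L hyperplane_proper[OF hyp[OF H]] by blast
    then show "H \<in> L \<and> (\<exists>X\<in>L. H \<subset> X \<and> (\<forall>Y\<in>L. H \<subset> Y \<longrightarrow> Y = X))" using A_L[OF H] by blast
  next
    assume "H \<in> L \<and> (\<exists>X\<in>L. H \<subset> X \<and> (\<forall>Y\<in>L. H \<subset> Y \<longrightarrow> Y = X))"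
    then obtain X where H: "H \<in> L" "X \<in> L" "H \<subset> X" and X: "\<forall>Y\<in>L. H \<subset> Y \<longrightarrow> Y = X" by metis
    have "H \<noteq> carrier V" using L_V[OF H(2)] H(3) by blast
    then obtain H' where H': "H' \<in> A" "H \<subseteq> H'" using below[OF H(1)] by blast
    \<comment> \<open>If \<open>H\<close> were strictly contained in \<open>H'\<close>, both
      \<open>H'\<close> and V would have to equal the unique element \<open>X\<close>, but
      \<open>H'\<close> is proper.\<close>
    have "H = H'"
      using bspec[OF X A_L[OF H'(1)]] bspec[OF X V_L] H'(2) hyperplane_proper[OF hyp[OF H'(1)]] by auto
    then show "H \<in> A" using H' by blast
  qed
qed

end

text \<open>Being a coatom is an order property, so the isomorphism restricts to a bijection of
  hyperplanes. It also carries intersections to intersections, and therefore respects containment of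
  an intersection in a hyperplane.\<close>

lemma lattice_iso_imp_closure_preserving_bij:
  assumes A: "arrangement K l A" and B: "arrangement K' l' B"
    and iso: "lattice_iso (intersection_lattice K' l' B) (intersection_lattice K l A)"
  obtains \<phi> where "bij_betw \<phi> B A"
    "\<And>T H. T \<subseteq> B \<Longrightarrow> H \<in> B \<Longrightarrow>
      inter_space K' l' T \<subseteq> H \<longleftrightarrow> inter_space K l (\<phi> ` T) \<subseteq> \<phi> H"
proof -
  interpret P: coordinate_space K l
    using A unfolding arrangement_def coordinate_space_def by blast
  interpret Q: coordinate_space K' l'
    using B unfolding arrangement_def coordinate_space_def by blast
  define L where "L = carrier (intersection_lattice K l A)"
  define M where "M = carrier (intersection_lattice K' l' B)"
  obtain \<phi> where bij: "bij_betw \<phi> M L"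
    and emb: "\<And>X Y. X \<in> M \<Longrightarrow> Y \<in> M \<Longrightarrow> \<phi> Y \<subseteq> \<phi> X \<longleftrightarrow> Y \<subseteq> X"
    using iso unfolding lattice_iso_def order_emb_def L_def M_def
    by (auto simp: intersection_lattice_def)
  have img: "\<phi> ` M = L" using bij by (auto simp: bij_betw_def)
  have \<phi>L: "\<phi> X \<in> L" if "X \<in> M" for X using bij that by (auto simp: bij_betw_def)
  have surj: "\<exists>X\<in>M. Y = \<phi> X" if "Y \<in> L" for Y using bij that by (auto simp: bij_betw_def)
  have inj: "\<phi> X = \<phi> Y \<longleftrightarrow> X = Y" if "X \<in> M" "Y \<in> M" for X Y
    using bij that by (auto simp: bij_betw_def inj_on_def)
  have strict: "\<phi> X \<subset> \<phi> Y \<longleftrightarrow> X \<subset> Y" if "X \<in> M" "Y \<in> M" for X Y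
    using emb[OF that] emb[OF that(2,1)] by blast
  have B_M: "H \<in> M" if "H \<in> B" for H
    using Q.hyperplane_iff_coatom[OF B] that unfolding M_def by blast
  have coatom: "\<phi> H \<in> A \<longleftrightarrow> H \<in> B" if H: "H \<in> M" for H
  proof -
    have "(\<exists>Y\<in>L. \<phi> H \<subset> Y \<and> (\<forall>Z\<in>L. \<phi> H \<subset> Z \<longrightarrow> Z = Y)) \<longleftrightarrow>
      (\<exists>X\<in>M. \<phi> H \<subset> \<phi> X \<and> (\<forall>Z\<in>M. \<phi> H \<subset> \<phi> Z \<longrightarrow> \<phi> Z = \<phi> X))"
      unfolding img[symmetric] by simp
    also have "\<dots> \<longleftrightarrow> (\<exists>X\<in>M. H \<subset> X \<and> (\<forall>Z\<in>M. H \<subset> Z \<longrightarrow> Z = X))"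
      using strict[OF H] inj by simp
    finally show ?thesis
      using P.hyperplane_iff_coatom[OF A, of "\<phi> H"] Q.hyperplane_iff_coatom[OF B, of H] H \<phi>L[OF H]
      unfolding L_def M_def by simp
  qed
  have A_L: "H \<in> L" if "H \<in> A" for H
    using P.hyperplane_iff_coatom[OF A] that unfolding L_def by blast
  have bijAB: "bij_betw \<phi> B A"
    unfolding bij_betw_def
  proof
    show "inj_on \<phi> B" using inj B_M by (auto simp: inj_on_def)
    show "\<phi> ` B = A" using coatom B_M A_L surj by blast
  qed
  have M_I: "inter_space K' l' T \<in> M" if "T \<subseteq> B" for T
    using that unfolding M_def intersection_lattice_def by auto
  have L_I: "inter_space K l T \<in> L" if "T \<subseteq> A" for T
    using that unfolding L_def intersection_lattice_def by auto
  \<comment> \<open>The intersection of \<open>T\<close> is the largest lattice element contained in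
    all members of \<open>T\<close>, a characterisation invariant under order isomorphism.\<close>
  have meet: "\<phi> (inter_space K' l' T) = inter_space K l (\<phi> ` T)" if T: "T \<subseteq> B" for T
  proof
    have "\<phi> (inter_space K' l' T) \<subseteq> \<phi> H" if "H \<in> T" for H
      using that T by (subst emb[OF B_M M_I[OF T]]) (auto simp: inter_space_def)
    moreover have "\<phi> (inter_space K' l' T) \<subseteq> carrier P.V"
      using \<phi>L[OF M_I[OF T]] unfolding L_def intersection_lattice_def inter_space_def by auto
    ultimately show "\<phi> (inter_space K' l' T) \<subseteq> inter_space K l (\<phi> ` T)"
      unfolding inter_space_def by blast
  next
    have "\<phi> ` T \<subseteq> A" using bijAB T by (auto simp: bij_betw_def)
    then obtain X where X: "X \<in> M" "inter_space K l (\<phi> ` T) = \<phi> X" using surj[OF L_I] by blast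
    have "X \<subseteq> H" if "H \<in> T" for H
    proof -
      have "\<phi> X \<subseteq> \<phi> H" using that unfolding X(2)[symmetric] inter_space_def by blast
      then show ?thesis using emb[OF B_M X(1)] T that by blast
    qed
    moreover have "X \<subseteq> carrier Q.V"
      using X(1) unfolding M_def intersection_lattice_def inter_space_def by auto
    ultimately have "X \<subseteq> inter_space K' l' T" unfolding inter_space_def by blast
    then show "inter_space K l (\<phi> ` T) \<subseteq> \<phi> (inter_space K' l' T)"
      using emb[OF M_I[OF T] X(1)] X(2) by simp
  qed
  have "inter_space K' l' T \<subseteq> H \<longleftrightarrow> inter_space K l (\<phi> ` T) \<subseteq> \<phi> H"
    if "T \<subseteq> B" "H \<in> B" for T H
    using emb[OF B_M[OF that(2)] M_I[OF that(1)]] meet[OF that(1)] by simp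
  then show ?thesis using that bijAB by blast
qed

section \<open>Transport of MAT-partitions\<close>

lemma card_image_cong_fibres:
  assumes "\<And>x y. x \<in> S \<Longrightarrow> y \<in> S \<Longrightarrow> f x = f y \<longleftrightarrow> g x = g y"
  shows "card (f ` S) = card (g ` S)"
proof -
  \<comment> \<open>Equal fibres make f x \<mapsto> g x a well-defined bijection between the images;
    it is evaluated at a chosen preimage under \<open>f\<close>.\<close>
  have "g ` S = (\<lambda>z. g (inv_into S f z)) ` f ` S"
    unfolding image_image
  proof (rule image_cong[OF refl])
    fix x assume "x \<in> S"
    then show "g x = g (inv_into S f (f x))"
      using assms[of x "inv_into S f (f x)"] by (simp add: inv_into_into f_inv_into_f)
  qed
  moreover have "inj_on (\<lambda>z. g (inv_into S f z)) (f ` S)"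
    using assms by (intro inj_onI) (metis f_inv_into_f inv_into_into)
  ultimately show ?thesis by (simp add: card_image)
qed

text \<open>The image partition inherits (a) as a family of containments and (c) because
  coincidences in a restriction are preserved. For (b), infinity of \<open>K'\<close> reduces
  covering by hyperplanes to containment in one.\<close>

lemma MAT_partition_transfer:
  assumes A: "arrangement K l A" and B: "arrangement K' l' B" and inf: "infinite (carrier K')"
    and bij: "bij_betw \<chi> A B"
    and closure: "\<And>T H. T \<subseteq> A \<Longrightarrow> H \<in> A \<Longrightarrow>
      inter_space K l T \<subseteq> H \<longleftrightarrow> inter_space K' l' (\<chi> ` T) \<subseteq> \<chi> H"
    and \<pi>: "MAT_partition K l A \<pi>"
  shows "MAT_partition K' l' B (map ((`) \<chi>) \<pi>)"
proof -
  interpret P: coordinate_space K l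
    using A unfolding arrangement_def coordinate_space_def by blast
  interpret Q: coordinate_space K' l'
    using B unfolding arrangement_def coordinate_space_def by blast
  have part: "ordered_partition \<pi> A" using \<pi> unfolding MAT_partition_def by blast
  have inj: "inj_on \<chi> A" and img: "\<chi> ` A = B" using bij by (auto simp: bij_betw_def)
  have hypA: "\<And>H. H \<in> A \<Longrightarrow> hyperplane K l H" using A unfolding arrangement_def by blast
  have hypB: "\<And>H. H \<in> B \<Longrightarrow> hyperplane K' l' H" using B unfolding arrangement_def by blast
  have block: "\<pi> ! k \<subseteq> A" if "k < length \<pi>" for k
    using part that unfolding ordered_partition_def by auto
  have prefix: "\<Union>(set (take k \<pi>)) \<subseteq> A" for k
    using part unfolding ordered_partition_def by (meson Union_mono order.trans set_take_subset equalityD1)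
  have prefix_map: "\<Union>(set (take k (map ((`) \<chi>) \<pi>))) = \<chi> ` \<Union>(set (take k \<pi>))" for k
    by (auto simp: take_map)
  \<comment> \<open>Equality of two traces on \<open>H\<close> is a pair of containments of a trace
    in a hyperplane; this gives the count in (c).\<close>
  have fibre: "X \<inter> H = Y \<inter> H \<longleftrightarrow> \<chi> X \<inter> \<chi> H = \<chi> Y \<inter> \<chi> H"
    if XYH: "X \<in> A" "Y \<in> A" "H \<in> A" for X Y H
  proof -
    have P: "X \<inter> H = inter_space K l {X, H}" if "X \<in> A" "H \<in> A" for X H
      using P.hyperplane_proper[OF hypA[OF that(1)]] unfolding inter_space_def by auto
    have Q: "\<chi> X \<inter> \<chi> H = inter_space K' l' (\<chi> ` {X, H})" if "X \<in> A" "H \<in> A" for X H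
      using Q.hyperplane_proper[OF hypB, of "\<chi> X"] that img unfolding inter_space_def by auto
    have "X \<inter> H = Y \<inter> H \<longleftrightarrow> X \<inter> H \<subseteq> Y \<and> Y \<inter> H \<subseteq> X" by blast
    also have "\<dots> \<longleftrightarrow> \<chi> X \<inter> \<chi> H \<subseteq> \<chi> Y \<and> \<chi> Y \<inter> \<chi> H \<subseteq> \<chi> X"
      using closure[of "{X, H}" Y] closure[of "{Y, H}" X] P Q XYH by simp
    finally show ?thesis by blast
  qed
  show ?thesis
  proof (rule Q.MAT_partitionI[OF B])
    show "ordered_partition (map ((`) \<chi>) \<pi>) B"
    proof -
      have "\<chi> ` (\<pi> ! i) \<inter> \<chi> ` (\<pi> ! j) = {}"
        if "i < length \<pi>" "j < length \<pi>" "i \<noteq> j" for i j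
        using inj_on_image_Int[OF inj block block, of i j] part that
        unfolding ordered_partition_def by auto
      then show ?thesis using part img unfolding ordered_partition_def by auto
    qed
  next
    fix k H' assume k: "k < length (map ((`) \<chi>) \<pi>)" and H': "H' \<in> map ((`) \<chi>) \<pi> ! k"
    then obtain H where H: "H \<in> \<pi> ! k" "H' = \<chi> H" by auto
    have HA: "H \<in> A" using block k H by auto
    have "map ((`) \<chi>) \<pi> ! k - {H'} = \<chi> ` (\<pi> ! k - {H})"
      using inj block k H by (auto simp: inj_on_def)
    moreover have "\<pi> ! k - {H} \<subseteq> A" using block[of k] k by auto
    moreover have "\<not> inter_space K l (\<pi> ! k - {H}) \<subseteq> H"
      using P.MAT_partition_imp_closure_conditions(1)[OF A \<pi>] k H by simp
    ultimately show "\<not> inter_space K' l' (map ((`) \<chi>) \<pi> ! k - {H'}) \<subseteq> H'"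
      using closure[of "\<pi> ! k - {H}" H] HA H(2) by simp
    have "card (restriction (\<chi> ` S) (\<chi> H)) = card (restriction S H)" if "S \<subseteq> A" for S
    proof -
      have "restriction (\<chi> ` S) (\<chi> H) = (\<lambda>X. \<chi> X \<inter> \<chi> H) ` S" "restriction S H = (\<lambda>X. X \<inter> H) ` S"
        unfolding restriction_def by auto
      then show ?thesis
        using card_image_cong_fibres[of S "\<lambda>X. X \<inter> H" "\<lambda>X. \<chi> X \<inter> \<chi> H"] fibre[OF _ _ HA] that
        by (simp add: subset_iff)
    qed
    moreover have "card (\<chi> ` S) = card S" if "S \<subseteq> A" for S
      using inj_on_subset[OF inj that] by (rule card_image)
    moreover have "int (card (\<Union>(set (take k \<pi>)))) - int (card (restriction (\<Union>(set (take k \<pi>))) H)) = int k"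
      using \<pi> k H unfolding MAT_partition_def Let_def by simp
    ultimately show "int (card (\<Union>(set (take k (map ((`) \<chi>) \<pi>))))) -
      int (card (restriction (\<Union>(set (take k (map ((`) \<chi>) \<pi>)))) H')) = int k"
      unfolding prefix_map H(2) using prefix by simp
  next
    fix k assume k: "k < length (map ((`) \<chi>) \<pi>)"
    let ?S = "\<chi> ` \<Union>(set (take k \<pi>))"
    have SB: "?S \<subseteq> B" using prefix img by blast
    show "\<not> inter_space K' l' (map ((`) \<chi>) \<pi> ! k) \<subseteq> \<Union>(\<Union>(set (take k (map ((`) \<chi>) \<pi>))))"
      unfolding prefix_map
    proof
      \<comment> \<open>A covering over the infinite field \<open>K'\<close> yields one earlier
        hyperplane containing the intersection; pulled back along \<open>\<chi>\<close>, this
        contradicts (b) for \<open>\<pi>\<close>.\<close>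
      assume cover: "inter_space K' l' (map ((`) \<chi>) \<pi> ! k) \<subseteq> \<Union>?S"
      have "map ((`) \<chi>) \<pi> ! k \<subseteq> B" using block k img by auto
      then have "subspace K' (inter_space K' l' (map ((`) \<chi>) \<pi> ! k)) Q.V"
        using hypB by (intro Q.subspace_inter_space) blast
      moreover have "finite ?S" using SB B finite_subset unfolding arrangement_def by blast
      moreover have "\<And>H. H \<in> ?S \<Longrightarrow> hyperplane K' l' H" using hypB SB by blast
      ultimately have "\<exists>H\<in>?S. inter_space K' l' (map ((`) \<chi>) \<pi> ! k) \<subseteq> H"
        using Q.subspace_subset_Union_hyperplanes[OF inf _ _ _ cover] by blast
      then obtain H where H: "H \<in> \<Union>(set (take k \<pi>))" "inter_space K' l' (\<chi> ` (\<pi> ! k)) \<subseteq> \<chi> H"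
        using k by auto
      then have "inter_space K l (\<pi> ! k) \<subseteq> H"
        using closure[of "\<pi> ! k" H] block[of k] k prefix[of k] by (simp add: subset_iff)
      then show False
        using P.MAT_partition_imp_closure_conditions(2)[OF A \<pi>] k H(1) by simp
    qed
  qed
qed

lemma combinatorial_within_infinite_fields:
  "combinatorial_within infinite_field_arrangements (MF \<inter> infinite_field_arrangements)"
  unfolding combinatorial_within_def
proof (intro allI impI, elim conjE)
  fix K :: "'u ring" and l A and K' :: "'u ring" and l' B
  assume KA: "(K, l, A) \<in> MF \<inter> infinite_field_arrangements"
    and KB: "(K', l', B) \<in> infinite_field_arrangements"
    and iso: "lattice_iso (intersection_lattice K' l' B) (intersection_lattice K l A)"
  have A: "arrangement K l A" and B: "arrangement K' l' B" and inf: "infinite (carrier K')"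
    using KA KB unfolding MF_def infinite_field_arrangements_def by auto
  obtain \<pi> where \<pi>: "MAT_partition K l A \<pi>" using KA unfolding MF_def MAT_free_def by auto
  obtain \<phi> where bij: "bij_betw \<phi> B A" and closure: "\<And>T H. T \<subseteq> B \<Longrightarrow> H \<in> B \<Longrightarrow>
      inter_space K' l' T \<subseteq> H \<longleftrightarrow> inter_space K l (\<phi> ` T) \<subseteq> \<phi> H"
    using lattice_iso_imp_closure_preserving_bij[OF A B iso] by blast
  \<comment> \<open>The isomorphism goes from the lattice of \<open>B\<close> to that of
    \<open>A\<close>, whereas the partition is carried from \<open>A\<close> to
    \<open>B\<close>.\<close>
  let ?\<chi> = "inv_into B \<phi>"
  have bij': "bij_betw ?\<chi> A B" by (rule bij_betw_inv_into[OF bij])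
  have inv: "\<phi> (?\<chi> H) = H" if "H \<in> A" for H using bij_betw_inv_into_right[OF bij that] .
  have "MAT_partition K' l' B (map ((`) ?\<chi>) \<pi>)"
  proof (rule MAT_partition_transfer[OF A B inf bij' _ \<pi>])
    fix T H assume TH: "T \<subseteq> A" "H \<in> A"
    have "\<phi> ` ?\<chi> ` T = T" using inv TH by (force simp: image_image)
    moreover have "?\<chi> ` T \<subseteq> B" "?\<chi> H \<in> B" using bij' TH by (auto simp: bij_betw_def)
    ultimately show "inter_space K l T \<subseteq> H \<longleftrightarrow> inter_space K' l' (?\<chi> ` T) \<subseteq> ?\<chi> H"
      using closure[of "?\<chi> ` T" "?\<chi> H"] inv TH by simp
  qed
  then show "(K', l', B) \<in> MF \<inter> infinite_field_arrangements"
    using KB B unfolding MF_def MAT_free_def by auto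
qed

section \<open>The Fano arrangement over fields with two and four elements\<close>

text \<open>
  Triples of truth values stand for vectors of $\mathbb{F}_2^3$ and, through \<open>dot\<close>, for linear forms
  on it; exclusive or is written \<open>\<noteq>\<close>.
\<close>

type_synonym triple = "bool \<times> bool \<times> bool"

fun dot :: "triple \<Rightarrow> triple \<Rightarrow> bool" where
  "dot (a, b, c) (x, y, z) = ((a \<and> x) \<noteq> ((b \<and> y) \<noteq> (c \<and> z)))"

fun vadd :: "triple \<Rightarrow> triple \<Rightarrow> triple" where
  "vadd (a, b, c) (x, y, z) = (a \<noteq> x, b \<noteq> y, c \<noteq> z)"

fun vscale :: "bool \<Rightarrow> triple \<Rightarrow> triple" where
  "vscale s (x, y, z) = (s \<and> x, s \<and> y, s \<and> z)"

abbreviation vnull :: triple where "vnull \<equiv> (False, False, False)"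

fun entry :: "triple \<Rightarrow> nat \<Rightarrow> bool" where
  "entry (x, y, z) i = (if i = 0 then x else if i = 1 then y else z)"

definition annihilator :: "triple set \<Rightarrow> triple set" where
  "annihilator S = {p. \<forall>a\<in>S. \<not> dot a p}"

lemma dot_vnull [simp]: "\<not> dot a vnull"
  by (cases a) simp

lemma dot_vadd [simp]: "dot a (vadd p q) = (dot a p \<noteq> dot a q)" "dot (vadd a b) p = (dot a p \<noteq> dot b p)"
  by (cases a; cases p; cases q; cases b; auto)+

lemma dot_vscale [simp]: "dot a (vscale s p) = (s \<and> dot a p)"
  by (cases a; cases p) auto

lemma vscale_simps [simp]: "vscale s vnull = vnull" "vscale False p = vnull" "vscale True p = p"
  by (cases p; simp)+

lemma vadd_simps [simp]: "vadd p vnull = p" "vadd vnull p = p" "vadd p p = vnull" "vadd p q = vnull \<longleftrightarrow> p = q"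
  by (cases p; cases q; auto)+

lemma vadd_cancel [simp]: "vadd (vadd p q) q = p"
  by (cases p; cases q; auto)

lemma entry_simps [simp]: "entry (vadd p q) i = (entry p i \<noteq> entry q i)" "entry (vscale s p) i = (s \<and> entry p i)"
  by (cases p; cases q; auto)+

lemma triple_eq_iff: "p = q \<longleftrightarrow> (\<forall>i<3. entry p i = entry q i)"
  by (cases p; cases q) (auto simp: numeral_3_eq_3 less_Suc_eq)

lemma dot_nondegenerate: "a \<noteq> vnull \<Longrightarrow> \<exists>p. dot a p"
  by (cases a) auto

lemma vnull_in_annihilator [simp]: "vnull \<in> annihilator S"
  unfolding annihilator_def by simp

lemma annihilator_singleton_inj: "annihilator {a} = annihilator {b} \<longleftrightarrow> a = b"
proof
  assume "annihilator {a} = annihilator {b}"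
  then have "dot a p = dot b p" for p unfolding annihilator_def by auto
  from this[of "(True, False, False)"] this[of "(False, True, False)"] this[of "(False, False, True)"]
  show "a = b" by (cases a; cases b) auto
qed simp

text \<open>The forms vanishing at \<open>p\<close> make up a space of dimension at least two. The
  witnesses are explicit, according to which of the first two coordinates of \<open>p\<close> is
  nonzero.\<close>

lemma two_annihilating_forms:
  obtains a b where "a \<noteq> vnull" "b \<noteq> vnull" "a \<noteq> b" "\<not> dot a p" "\<not> dot b p"
proof -
  obtain x y z where p: "p = (x, y, z)" by (cases p)
  consider x | "\<not> x" y | "\<not> x" "\<not> y" by blast
  then show ?thesis
  proof cases
    case 1
    then show ?thesis using that[of "(y, True, False)" "(z, False, True)"] p by auto
  next
    case 2
    then show ?thesis using that[of "(True, False, False)" "(False, z, True)"] p by auto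
  next
    case 3
    then show ?thesis using that[of "(True, False, False)" "(False, True, False)"] p by auto
  qed
qed

text \<open>
  With $\omega^2 = \omega + 1$, the element $a + b\omega$ of $\mathbb{F}_4$ is coded by \<open>g (a, b)\<close>.
  \<open>GF True\<close> is $\mathbb{F}_4$ and \<open>GF False\<close> is its prime field $\mathbb{F}_2$. Likewise \<open>vec p q\<close> is
  $p + \omega q$, and \<open>ext e P\<close> is the scalar extension of the subspace $P$ of $\mathbb{F}_2^3$.
\<close>

locale coded_four_field =
  fixes g :: "bool \<times> bool \<Rightarrow> 'u"
  assumes inj_g: "inj g"
begin

definition GF :: "bool \<Rightarrow> 'u ring" where
  "GF e = \<lparr>carrier = {g (a, b) |a b. b \<longrightarrow> e},
    mult = (\<lambda>x y. case (inv_into UNIV g x, inv_into UNIV g y) of ((a, b), (c, d)) \<Rightarrow>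
      g ((a \<and> c) \<noteq> (b \<and> d), (a \<and> d) \<noteq> ((b \<and> c) \<noteq> (b \<and> d)))),
    one = g (True, False),
    zero = g (False, False),
    add = (\<lambda>x y. case (inv_into UNIV g x, inv_into UNIV g y) of ((a, b), (c, d)) \<Rightarrow> g (a \<noteq> c, b \<noteq> d))\<rparr>"

lemma g_eq_iff [simp]: "g x = g y \<longleftrightarrow> x = y"
  using inj_g by (simp add: inj_eq)

lemma GF_simps:
  "carrier (GF e) = {g (a, b) |a b. b \<longrightarrow> e}"
  "g (a, b) \<otimes>\<^bsub>GF e\<^esub> g (c, d) = g ((a \<and> c) \<noteq> (b \<and> d), (a \<and> d) \<noteq> ((b \<and> c) \<noteq> (b \<and> d)))"
  "g (a, b) \<oplus>\<^bsub>GF e\<^esub> g (c, d) = g (a \<noteq> c, b \<noteq> d)"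
  "\<one>\<^bsub>GF e\<^esub> = g (True, False)"
  "\<zero>\<^bsub>GF e\<^esub> = g (False, False)"
  unfolding GF_def using inj_g by simp_all

lemma field_GF: "field (GF e)"
proof (rule cring.cring_fieldI)
  show cring: "cring (GF e)"
  proof (rule cringI)
    show "abelian_group (GF e)"
    proof (rule abelian_groupI)
      show "\<exists>y\<in>carrier (GF e). y \<oplus>\<^bsub>GF e\<^esub> x = \<zero>\<^bsub>GF e\<^esub>" if "x \<in> carrier (GF e)" for x
        using that by (intro bexI[of _ x]) (auto simp: GF_simps)
    qed (auto simp: GF_simps)
    show "Group.comm_monoid (GF e)"
      by (rule comm_monoidI) (auto simp: GF_simps)
  qed (auto simp: GF_simps)
  then interpret cring "GF e" .
  have inverse: "\<exists>y\<in>carrier (GF e). x \<otimes>\<^bsub>GF e\<^esub> y = \<one>\<^bsub>GF e\<^esub>" if "x \<in> carrier (GF e)" "x \<noteq> \<zero>\<^bsub>GF e\<^esub>" for x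
  proof -
    obtain a b where x: "x = g (a, b)" "b \<longrightarrow> e" using \<open>x \<in> carrier (GF e)\<close> unfolding GF_simps by blast
    then have "a \<or> b" using that by (auto simp: GF_simps)
    \<comment> \<open>The inverse of a + b \<omega> is its conjugate (a + b) + b \<omega>, since the
      norm a + ab + b of a nonzero element is 1.\<close>
    with x show ?thesis
      by (intro bexI[of _ "g (a \<noteq> b, b)"]) (auto simp: GF_simps)
  qed
  have "x \<in> Units (GF e)" if "x \<in> carrier (GF e)" "x \<noteq> \<zero>\<^bsub>GF e\<^esub>" for x
  proof -
    obtain y where "y \<in> carrier (GF e)" "x \<otimes>\<^bsub>GF e\<^esub> y = \<one>\<^bsub>GF e\<^esub>"
      using inverse \<open>x \<in> carrier (GF e)\<close> \<open>x \<noteq> \<zero>\<^bsub>GF e\<^esub>\<close> by blast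
    then show ?thesis using that m_comm[of x y] unfolding Units_def by auto
  qed
  moreover have "\<zero>\<^bsub>GF e\<^esub> \<notin> Units (GF e)" 
    unfolding Units_def by (auto simp: GF_simps)
  ultimately show "Units (GF e) = carrier (GF e) - {\<zero>\<^bsub>GF e\<^esub>}" by (auto)
qed

definition vec :: "triple \<Rightarrow> triple \<Rightarrow> nat \<Rightarrow> 'u" where
  "vec p q = (\<lambda>i\<in>{..<3}. g (entry p i, entry q i))"

definition ext :: "bool \<Rightarrow> triple set \<Rightarrow> (nat \<Rightarrow> 'u) set" where
  "ext e P = {vec p q |p q. p \<in> P \<and> q \<in> P \<and> (q = vnull \<or> e)}"

text \<open>A form \<open>a\<close> with coefficients in F_2 vanishes at p + \<omega> q iff it
  vanishes at both p and q, so its kernel is the scalar extension of its kernel over F_2.\<close>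

definition hyp :: "bool \<Rightarrow> triple \<Rightarrow> (nat \<Rightarrow> 'u) set" where
  "hyp e a = ext e (annihilator {a})"

definition arr :: "bool \<Rightarrow> (nat \<Rightarrow> 'u) set set" where
  "arr e = hyp e ` (- {vnull})"

lemma vec_eq_iff [simp]: "vec p q = vec p' q' \<longleftrightarrow> p = p' \<and> q = q'"
  unfolding vec_def triple_eq_iff by (auto simp: fun_eq_iff restrict_def)

end

section \<open>The Fano arrangement as an extension of scalars from F_2\<close>

locale fano_arrangement = coded_four_field g for g :: "bool \<times> bool \<Rightarrow> 'u" + fixes e :: bool
begin

sublocale coordinate_space "GF e" 3
  unfolding coordinate_space_def by (rule field_GF)

lemma carrier_V_eq: "carrier V = ext e UNIV"
proof
  show "ext e UNIV \<subseteq> carrier V"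
  proof
    fix x assume "x \<in> ext e UNIV"
    then obtain p q where "x = vec p q" "q = vnull \<or> e" unfolding ext_def by blast
    then show "x \<in> carrier V" by (auto simp: vec_def carrier_V GF_simps)
  qed
next
  show "carrier V \<subseteq> ext e UNIV"
  proof
    fix x assume x: "x \<in> carrier V"
    then have "\<exists>a b. x i = g (a, b) \<and> (b \<longrightarrow> e)" if "i < 3" for i
      using that unfolding carrier_V GF_simps by (auto dest: PiE_mem)
    then obtain a b where ab: "\<And>i. i < 3 \<Longrightarrow> x i = g (a i, b i)" "\<And>i. i < 3 \<Longrightarrow> b i \<Longrightarrow> e"
      by metis
    have "x = vec (a 0, a 1, a 2) (b 0, b 1, b 2)"
    proof
      fix i :: nat
      consider "i = 0" | "i = 1" | "i = 2" | "\<not> i < 3" by linarith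
      then show "x i = vec (a 0, a 1, a 2) (b 0, b 1, b 2) i"
        using x ab(1) by cases (auto simp: vec_def carrier_V PiE_def extensional_def)
    qed
    moreover have "(b 0, b 1, b 2) = vnull \<or> e" using ab(2)[of 0] ab(2)[of 1] ab(2)[of 2] by auto
    ultimately show "x \<in> ext e UNIV" unfolding ext_def by blast
  qed
qed

text \<open>The last equation expands (c + d \<omega>)(p + \<omega> q) with \<omega> * \<omega> =
  \<omega> + 1.\<close>

lemma vec_ops:
  "\<zero>\<^bsub>V\<^esub> = vec vnull vnull"
  "vec p q \<oplus>\<^bsub>V\<^esub> vec p' q' = vec (vadd p p') (vadd q q')"
  "g (c, d) \<odot>\<^bsub>V\<^esub> vec p q = vec (vadd (vscale c p) (vscale d q)) (vadd (vscale c q) (vadd (vscale d p) (vscale d q)))"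
  unfolding zero_V add_V smult_V vec_def by (auto simp: GF_simps fun_eq_iff restrict_def)

lemma in_ext_iff: "vec p q \<in> ext e P \<longleftrightarrow> p \<in> P \<and> q \<in> P \<and> (q = vnull \<or> e)"
  unfolding ext_def mem_Collect_eq vec_eq_iff by blast

text \<open>The vectors \<open>vec p vnull\<close> recover \<open>P\<close>, and
  \<open>vnull \<in> P\<close> puts them into \<open>ext e P\<close> for either value of
  \<open>e\<close>. Hence containments do not depend on the field.\<close>

lemma ext_subset_iff: "vnull \<in> P \<Longrightarrow> ext e P \<subseteq> ext e Q \<longleftrightarrow> P \<subseteq> Q"
  using in_ext_iff[of _ vnull] unfolding ext_def by blast

lemma ext_cases:
  assumes "x \<in> ext e P"
  obtains p q where "x = vec p q" "p \<in> P" "q \<in> P" "q = vnull \<or> e"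
  using assms unfolding ext_def by blast

lemma ext_Int: "ext e P \<inter> ext e Q = ext e (P \<inter> Q)"
  by (intro subset_antisym subsetI) (elim IntE ext_cases; simp add: in_ext_iff)+

lemma hyp_eq_iff [simp]: "hyp e a = hyp e b \<longleftrightarrow> a = b"
  using ext_subset_iff vnull_in_annihilator annihilator_singleton_inj unfolding hyp_def
  by (metis order_antisym_conv order_refl)

text \<open>Membership of \<open>vec p q\<close> is tested on p and q separately, so extension of
  scalars commutes with intersections.\<close>

lemma inter_space_hyp: "inter_space (GF e) 3 (hyp e ` S) = ext e (annihilator S)"
proof (intro subset_antisym subsetI)
  fix x assume x: "x \<in> inter_space (GF e) 3 (hyp e ` S)"
  then obtain p q where pq: "x = vec p q" "q = vnull \<or> e"
    unfolding inter_space_def carrier_V_eq by (blast elim: ext_cases)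
  have "x \<in> ext e (annihilator {a})" if "a \<in> S" for a
    using x that unfolding inter_space_def hyp_def by blast
  then show "x \<in> ext e (annihilator S)"
    using pq(2) unfolding pq(1) in_ext_iff annihilator_def by blast
next
  fix x assume "x \<in> ext e (annihilator S)"
  then show "x \<in> inter_space (GF e) 3 (hyp e ` S)"
    by (elim ext_cases) (simp add: inter_space_def carrier_V_eq hyp_def in_ext_iff annihilator_def)
qed

lemma inter_space_hyp_subset_iff:
  "inter_space (GF e) 3 (hyp e ` S) \<subseteq> hyp e a \<longleftrightarrow> annihilator S \<subseteq> annihilator {a}"
  unfolding inter_space_hyp hyp_def by (rule ext_subset_iff) simp

lemma hyperplane_hyp:
  assumes "a \<noteq> vnull"
  shows "hyperplane (GF e) 3 (hyp e a)"
proof -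
  obtain u where u: "dot a u" using dot_nondegenerate[OF assms] by blast
  show ?thesis
  proof (rule hyperplaneI)
    show "subspace (GF e) (hyp e a) V"
    proof (rule subspaceI)
      show "hyp e a \<subseteq> carrier V" unfolding hyp_def carrier_V_eq by (simp add: ext_subset_iff)
      show "\<zero>\<^bsub>V\<^esub> \<in> hyp e a" by (simp add: vec_ops hyp_def in_ext_iff)
      show "v \<oplus>\<^bsub>V\<^esub> w \<in> hyp e a" if "v \<in> hyp e a" "w \<in> hyp e a" for v w
        using that unfolding hyp_def
        by (elim ext_cases) (auto simp: vec_ops in_ext_iff annihilator_def)
      show "c \<odot>\<^bsub>V\<^esub> v \<in> hyp e a" if c: "c \<in> carrier (GF e)" and v: "v \<in> hyp e a" for c v
      proof -
        obtain b d where "c = g (b, d)" "d \<longrightarrow> e" using c unfolding GF_simps by blast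
        then show ?thesis
          using v unfolding hyp_def
          by (elim ext_cases) (auto simp: vec_ops in_ext_iff annihilator_def)
      qed
    qed
    show "vec u vnull \<in> carrier V" "vec u vnull \<notin> hyp e a"
      using u by (auto simp: carrier_V_eq hyp_def in_ext_iff annihilator_def)
    fix x assume "x \<in> carrier V"
    then obtain p q where x: "x = vec p q" "q = vnull \<or> e" unfolding carrier_V_eq ext_def by auto
    \<comment> \<open>This is the projection onto the kernel of \<open>a\<close> along
      \<open>u\<close>, where a takes the value 1; in characteristic two subtraction is
      addition.\<close>
    let ?w = "vec (vadd p (vscale (dot a p) u)) (vadd q (vscale (dot a q) u))"
    have "x = ?w \<oplus>\<^bsub>V\<^esub> g (dot a p, dot a q) \<odot>\<^bsub>V\<^esub> vec u vnull"
      by (simp add: x(1) vec_ops)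
    moreover have "?w \<in> hyp e a" using x(2) u by (auto simp: hyp_def in_ext_iff annihilator_def)
    moreover have "g (dot a p, dot a q) \<in> carrier (GF e)" using x(2) by (auto simp: GF_simps)
    ultimately show "\<exists>w\<in>hyp e a. \<exists>c\<in>carrier (GF e). x = w \<oplus>\<^bsub>V\<^esub> c \<odot>\<^bsub>V\<^esub> vec u vnull" by blast
  qed
qed

lemma arrangement_arr: "arrangement (GF e) 3 (arr e)"
  unfolding arrangement_def arr_def using field_GF hyperplane_hyp by auto

lemma carrier_lattice_arr:
  "carrier (intersection_lattice (GF e) 3 (arr e)) = ext e ` annihilator ` Pow (- {vnull})"
proof -
  have "carrier (intersection_lattice (GF e) 3 (arr e)) = inter_space (GF e) 3 ` Pow (arr e)"
    unfolding intersection_lattice_def by auto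
  also have "Pow (arr e) = (`) (hyp e) ` Pow (- {vnull})"
    unfolding arr_def by (rule image_Pow_surj[OF refl, symmetric])
  finally show ?thesis by (simp add: image_image inter_space_hyp)
qed

lemma hyp_Int: "hyp e a \<inter> hyp e b = ext e (annihilator {a, b})"
  unfolding hyp_def ext_Int by (rule arg_cong[of _ _ "ext e"]) (auto simp: annihilator_def)

end

section \<open>Failure over two elements and the isomorphism of the lattices\<close>

context coded_four_field
begin

text \<open>
  A point of the last block that avoids all earlier blocks lies on no hyperplane outside the last
  block. So that block contains three hyperplanes with linear forms $a$, $b$, $a + b$.
\<close>

lemma not_MAT_free_two_elements: "\<not> MAT_free (GF False) 3 (arr False)"
proof
  interpret fano_arrangement g False by unfold_locales
  assume "MAT_free (GF False) 3 (arr False)"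
  then obtain \<pi> where \<pi>: "MAT_partition (GF False) 3 (arr False) \<pi>" unfolding MAT_free_def by blast
  then have part: "ordered_partition \<pi> (arr False)" unfolding MAT_partition_def by blast
  have "hyp False (True, True, True) \<in> arr False" unfolding arr_def by blast
  then have "\<pi> \<noteq> []" using part unfolding ordered_partition_def by auto
  then obtain k where k: "length \<pi> = Suc k" by (cases \<pi>) auto
  let ?A = "\<Union>(set (take k \<pi>))"
  have "\<pi> = take k \<pi> @ [\<pi> ! k]"
    using k take_Suc_conv_app_nth[of k \<pi>] by simp
  then have "set \<pi> = set (take k \<pi> @ [\<pi> ! k])" by (rule arg_cong)
  then have split: "arr False = ?A \<union> \<pi> ! k" using part unfolding ordered_partition_def by auto
  obtain v where v: "v \<in> inter_space (GF False) 3 (\<pi> ! k)" "v \<notin> \<Union>?A"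
    using \<pi> k unfolding MAT_partition_def Let_def by (metis lessI subsetI)
  then obtain p where p: "v = vec p vnull"
    unfolding inter_space_def carrier_V_eq by (auto elim: ext_cases)
  have last: "hyp False a \<in> \<pi> ! k" if "a \<noteq> vnull" "\<not> dot a p" for a
  proof -
    have "v \<in> hyp False a" using that p by (simp add: hyp_def in_ext_iff annihilator_def)
    then show ?thesis using that v(2) split unfolding arr_def by blast
  qed
  obtain a b where ab: "a \<noteq> vnull" "b \<noteq> vnull" "a \<noteq> b" "\<not> dot a p" "\<not> dot b p"
    using two_annihilating_forms by blast
  let ?c = "vadd a b"
  \<comment> \<open>The form a + b is nonzero as a and b differ, and differs from each of them as
    the other is nonzero. It also vanishes at \<open>p\<close>, so its hyperplane is in the last
    block.\<close>
  have "?c \<noteq> vnull" "?c \<noteq> a" "?c \<noteq> b" using ab by (cases a; cases b; auto)+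
  then have "hyp False ` {a, b} \<subseteq> \<pi> ! k - {hyp False ?c}" and c: "hyp False ?c \<in> \<pi> ! k"
    using last ab by auto
  \<comment> \<open>Common zeros of a and b are zeros of a + b, which contradicts the independence
    that (a) imposes on the last block.\<close>
  then have "inter_space (GF False) 3 (\<pi> ! k - {hyp False ?c}) \<subseteq> inter_space (GF False) 3 (hyp False ` {a, b})"
    by (intro inter_space_antimono)
  also have "\<dots> \<subseteq> hyp False ?c"
    unfolding inter_space_hyp_subset_iff by (auto simp: annihilator_def)
  finally show False
    using MAT_partition_imp_closure_conditions(1)[OF arrangement_arr \<pi> _ c] k by simp
qed

text \<open>The map takes the vectors over F_2 in a subspace and extends scalars to the other field.
  It thus identifies both lattices with the annihilators in F_2^3.\<close>

lemma lattice_iso_arr: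
  "lattice_iso (intersection_lattice (GF e) 3 (arr e)) (intersection_lattice (GF e') 3 (arr e'))"
proof -
  interpret P: fano_arrangement g e by unfold_locales
  interpret Q: fano_arrangement g e' by unfold_locales
  define \<phi> where "\<phi> X = ext e' {p. vec p vnull \<in> X}" for X
  have \<phi>: "\<phi> (ext e (annihilator S)) = ext e' (annihilator S)" for S
    unfolding \<phi>_def by (simp add: P.in_ext_iff)
  have order: "weak_partial_order (intersection_lattice K l A)" for K :: "'u ring" and l A
    by unfold_locales (auto simp: intersection_lattice_def)
  have "bij_betw \<phi> (ext e ` annihilator ` Pow (- {vnull})) (ext e' ` annihilator ` Pow (- {vnull}))"
    unfolding bij_betw_def
    by (auto simp: inj_on_def image_image \<phi> P.ext_subset_iff Q.ext_subset_iff set_eq_subset)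
  moreover have "order_emb (intersection_lattice (GF e) 3 (arr e)) (intersection_lattice (GF e') 3 (arr e')) \<phi>"
    unfolding order_emb_def P.carrier_lattice_arr
    using order by (auto simp: \<phi> P.ext_subset_iff Q.ext_subset_iff intersection_lattice_def)
  ultimately show ?thesis
    unfolding lattice_iso_def P.carrier_lattice_arr Q.carrier_lattice_arr by blast
qed

end

section \<open>Evaluation of the MAT conditions on explicit blocks\<close>

definition fano_blocks :: "triple list list" where
  "fano_blocks =
    [[(True, False, False), (False, True, False), (False, False, True)],
     [(True, True, False), (False, True, True)], [(True, True, True)], [(True, False, True)]]"

lemma length_fano_blocks: "length fano_blocks = 4"
  unfolding fano_blocks_def by simp

lemma Union_fano_blocks: "\<Union>(set (map set fano_blocks)) = - {vnull}"
  unfolding fano_blocks_def by (auto simp: set_eq_iff)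

lemma fano_blocks_disjoint:
  assumes "i < 4" "j < 4" "i \<noteq> j"
  shows "set (fano_blocks ! i) \<inter> set (fano_blocks ! j) = {}"
proof -
  have "list_all (\<lambda>i. list_all (\<lambda>j. i = j \<or> list_all (\<lambda>a. a \<notin> set (fano_blocks ! j)) (fano_blocks ! i)) [0..<4]) [0..<4]"
    by code_simp
  then have "\<forall>i<4. \<forall>j<4. i = j \<or> (\<forall>a\<in>set (fano_blocks ! i). a \<notin> set (fano_blocks ! j))"
    by (simp add: list_all_iff)
  with assms show ?thesis by blast
qed

text \<open>The vector \<open>p\<close> lies on the hyperplanes of all other forms in the block but
  not on that of \<open>a\<close>, which is the containment form of (a). It is found by searching
  all eight triples.\<close>

lemma fano_blocks_independent:
  assumes "k < 4" "a \<in> set (fano_blocks ! k)"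
  shows "\<exists>p. dot a p \<and> (\<forall>b\<in>set (fano_blocks ! k) - {a}. \<not> dot b p)"
proof -
  have "list_all (\<lambda>k. list_all (\<lambda>a. list_ex (\<lambda>p. dot a p \<and> list_all (\<lambda>b. b = a \<or> \<not> dot b p) (fano_blocks ! k))
    Enum.enum) (fano_blocks ! k)) [0..<4]"
    by code_simp
  then have "list_ex (\<lambda>p. dot a p \<and> list_all (\<lambda>b. b = a \<or> \<not> dot b p) (fano_blocks ! k)) Enum.enum"
    using assms by (simp add: list_all_iff)
  then show ?thesis unfolding list_ex_iff list_all_iff by blast
qed

text \<open>The pair stands for the point p + \<omega> q over F_4, which is off the hyperplane of
  \<open>b\<close> as soon as \<open>b\<close> is nonzero at p or at q. This point witnesses
  (b).\<close>

lemma fano_blocks_avoid: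
  assumes "k < 4"
  shows "\<exists>p q. (\<forall>a\<in>set (fano_blocks ! k). \<not> dot a p \<and> \<not> dot a q) \<and>
    (\<forall>b\<in>set (concat (take k fano_blocks)). dot b p \<or> dot b q)"
proof -
  have "list_all (\<lambda>k. list_ex (\<lambda>p. list_ex (\<lambda>q.
      list_all (\<lambda>a. \<not> dot a p \<and> \<not> dot a q) (fano_blocks ! k) \<and>
      list_all (\<lambda>b. dot b p \<or> dot b q) (concat (take k fano_blocks))) Enum.enum) Enum.enum) [0..<4]"
    by code_simp
  then have "list_ex (\<lambda>p. list_ex (\<lambda>q.
      list_all (\<lambda>a. \<not> dot a p \<and> \<not> dot a q) (fano_blocks ! k) \<and>
      list_all (\<lambda>b. dot b p \<or> dot b q) (concat (take k fano_blocks))) Enum.enum) Enum.enum"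
    using assms by (simp add: list_all_iff)
  then show ?thesis unfolding list_ex_iff list_all_iff by blast
qed

lemma fano_blocks_card:
  assumes "k < 4" "a \<in> set (fano_blocks ! k)"
  defines "T \<equiv> set (concat (take k fano_blocks))"
  shows "card T = card ((\<lambda>b. annihilator {b, a}) ` T) + k"
proof -
  \<comment> \<open>The annihilator of a and b is listed in the order of a fixed enumeration, so
    equal sets give equal lists and the count becomes executable.\<close>
  define f where "f a b = filter (\<lambda>p. \<not> dot b p \<and> \<not> dot a p) Enum.enum" for a b
  have "list_all (\<lambda>k. list_all (\<lambda>a. length (remdups (concat (take k fano_blocks))) =
    length (remdups (map (\<lambda>b. filter (\<lambda>p. \<not> dot b p \<and> \<not> dot a p) Enum.enum) (concat (take k fano_blocks)))) + k)
    (fano_blocks ! k)) [0..<4]"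
    by code_simp
  then have "card T = card (f a ` T) + k"
    using assms(1,2) unfolding T_def f_def length_remdups_card_conv by (simp add: list_all_iff)
  moreover have "card ((\<lambda>b. annihilator {b, a}) ` T) = card (f a ` T)"
  proof (rule card_image_cong_fibres)
    have ann: "annihilator {b, a} = set (f a b)" for b
      unfolding annihilator_def f_def by (auto simp: enum_UNIV)
    have f: "f a b = filter (\<lambda>p. p \<in> annihilator {b, a}) Enum.enum" for b
      unfolding f_def annihilator_def by simp
    show "annihilator {b, a} = annihilator {c, a} \<longleftrightarrow> f a b = f a c" for b c
      using ann f by metis
  qed
  ultimately show ?thesis by simp
qed

section \<open>MAT-freeness over four elements\<close>

context coded_four_field
begin

lemma MAT_free_four_elements: "MAT_free (GF True) 3 (arr True)"
proof -
  interpret fano_arrangement g True by unfold_locales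
  let ?\<pi> = "map (\<lambda>xs. hyp True ` set xs) fano_blocks"
  have prefix: "\<Union>(set (take k ?\<pi>)) = hyp True ` set (concat (take k fano_blocks))" for k
    by (auto simp: take_map)
  have "MAT_partition (GF True) 3 (arr True) ?\<pi>"
  proof (rule MAT_partitionI[OF arrangement_arr])
    have "\<Union>(set ?\<pi>) = arr True"
      unfolding arr_def Union_fano_blocks[symmetric] by auto
    moreover have "{} \<notin> set ?\<pi>" unfolding fano_blocks_def by simp
    moreover have "?\<pi> ! i \<inter> ?\<pi> ! j = {}" if "i < length ?\<pi>" "j < length ?\<pi>" "i \<noteq> j" for i j
      using fano_blocks_disjoint[of i j] that by (auto simp: length_fano_blocks)
    ultimately show "ordered_partition ?\<pi> (arr True)"
      unfolding ordered_partition_def by blast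
  next
    fix k assume k: "k < length ?\<pi>"
    then have k4: "k < 4" by (simp add: length_fano_blocks)
    have block: "?\<pi> ! k = hyp True ` set (fano_blocks ! k)" using k by simp
    obtain p q where pq: "\<forall>a\<in>set (fano_blocks ! k). \<not> dot a p \<and> \<not> dot a q"
      "\<forall>b\<in>set (concat (take k fano_blocks)). dot b p \<or> dot b q"
      using fano_blocks_avoid[OF k4] by blast
    have "vec p q \<in> inter_space (GF True) 3 (?\<pi> ! k)"
      unfolding block inter_space_hyp in_ext_iff using pq(1) by (simp add: annihilator_def)
    moreover have "vec p q \<notin> \<Union>(\<Union>(set (take k ?\<pi>)))"
      unfolding prefix using pq(2) by (simp add: hyp_def in_ext_iff annihilator_def)
    ultimately show "\<not> inter_space (GF True) 3 (?\<pi> ! k) \<subseteq> \<Union>(\<Union>(set (take k ?\<pi>)))" by blast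
    fix H assume "H \<in> ?\<pi> ! k"
    then obtain a where a: "a \<in> set (fano_blocks ! k)" "H = hyp True a" unfolding block by blast
    have others: "?\<pi> ! k - {hyp True a} = hyp True ` (set (fano_blocks ! k) - {a})"
      unfolding block by auto
    obtain r where "dot a r" "\<forall>b\<in>set (fano_blocks ! k) - {a}. \<not> dot b r"
      using fano_blocks_independent[OF k4 a(1)] by blast
    then have "r \<in> annihilator (set (fano_blocks ! k) - {a})" "r \<notin> annihilator {a}"
      by (simp_all add: annihilator_def)
    then show "\<not> inter_space (GF True) 3 (?\<pi> ! k - {H}) \<subseteq> H"
      unfolding a(2) others inter_space_hyp_subset_iff by blast
    let ?T = "set (concat (take k fano_blocks))"
    have "restriction (hyp True ` ?T) H = (\<lambda>b. hyp True b \<inter> hyp True a) ` ?T"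
      unfolding restriction_def a(2) by blast
    then have "restriction (hyp True ` ?T) H = ext True ` (\<lambda>b. annihilator {b, a}) ` ?T"
      unfolding hyp_Int image_image .
    \<comment> \<open>All annihilators contain \<open>vnull\<close>, so they are recovered from
      their extensions and the restriction can be counted over F_2.\<close>
    moreover have "inj_on (ext True) ((\<lambda>b. annihilator {b, a}) ` ?T)"
    proof (rule inj_onI)
      fix P Q
      assume PQ: "P \<in> (\<lambda>b. annihilator {b, a}) ` ?T" "Q \<in> (\<lambda>b. annihilator {b, a}) ` ?T"
        and eq: "ext True P = ext True Q"
      have "vnull \<in> P" "vnull \<in> Q" using PQ by auto
      then have "P \<subseteq> Q" "Q \<subseteq> P" using ext_subset_iff[of P Q] ext_subset_iff[of Q P] eq by simp_all
      then show "P = Q" by (rule subset_antisym)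
    qed
    ultimately have "card (restriction (hyp True ` ?T) H) = card ((\<lambda>b. annihilator {b, a}) ` ?T)"
      by (simp add: card_image)
    moreover have "card (hyp True ` ?T) = card ?T"
      by (rule card_image) (simp add: inj_on_def)
    ultimately show "int (card (\<Union>(set (take k ?\<pi>)))) -
      int (card (restriction (\<Union>(set (take k ?\<pi>))) H)) = int k"
      unfolding prefix using fano_blocks_card[OF k4 a(1)] by simp
  qed
  then show ?thesis unfolding MAT_free_def by blast
qed

end

theorem theorem1p1:
  assumes "infinite (UNIV :: 'u set)"
  shows "\<not> combinatorial (MF :: 'u arr set) \<and>
    combinatorial_within infinite_field_arrangements
      (MF \<inter> infinite_field_arrangements :: 'u arr set)"
proof
  obtain f :: "nat \<Rightarrow> 'u" where f: "inj f"
    using infinite_countable_subset[OF assms] by blast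
  \<comment> \<open>The pairs become the binary codes 0, 1, 2, 3, so four distinct elements of
    \<open>'u\<close> carry the field F_4.\<close>
  define g :: "bool \<times> bool \<Rightarrow> 'u" where "g = (\<lambda>(a, b). f (2 * of_bool a + of_bool b))"
  have "inj g" unfolding g_def using f by (auto simp: inj_on_def split: if_splits)
  then interpret coded_four_field g by unfold_locales
  interpret P: fano_arrangement g False by unfold_locales
  interpret Q: fano_arrangement g True by unfold_locales
  have "(GF True, 3, arr True) \<in> MF"
    using Q.arrangement_arr MAT_free_four_elements unfolding MF_def by blast
  moreover have "(GF False, 3, arr False) \<in> all_arrangements"
    using P.arrangement_arr unfolding all_arrangements_def by blast
  moreover have "(GF False, 3, arr False) \<notin> MF"
    using not_MAT_free_two_elements unfolding MF_def by blast
  ultimately show "\<not> combinatorial (MF :: 'u arr set)"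
    using lattice_iso_arr unfolding combinatorial_within_def by blast
qed (rule combinatorial_within_infinite_fields)

end
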